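(* Let $A$ be an $n\times n$ real skew-symmetric matrix whose underlying graph $G$ is a tree, and let $\mu(G)$ be the size (number of edges) of a maximum matching of $G$. Then the ppr-sequence ${\rm ppr}(A)=r_0r_1\cdots r_n$ satisfies: for $0\le k\le n$, $r_k=1$ if and only if $k$ is even and $k\le 2\mu(G)$. Furthermore, every such sequence is realizable by a skew-symmetric matrix whose underlying graph is a tree: for every integer $m$ that is the maximum matching size of some tree on $n$ vertices, there is an $n\times n$ skew-symmetric real matrix whose underlying graph is a tree and whose ppr-sequence has $r_k=1$ exactly when $k$ is even and $k\le 2m$.
   Context: A real matrix $A$ is skew-symmetric if $A_{ji}=-A_{ij}$ for all $i,j$. The underlying graph of $A$ is the simple undirected graph on $[n]$ with edge $\{i,j\}$ iff $A_{ij}\neq 0$ (the pattern of a skew-symmetric matrix is symmetric with zero diagonal). The permanent of a $p\times p$ matrix is ${\rm per}(A)=\sum_{\sigma\in S_p}\prod_{i=1}^p a_{i\sigma(i)}$. The ppr-sequence of an $n\times n$ matrix $A$ is $r_0r_1\cdots r_n$ where, for $1\le k\le n$, $r_k=1$ iff $A$ has a principal submatrix of size $k$ with nonzero permanent (else $0$), and $r_0=1$ iff $A$ has a zero entry on its main diagonal. *)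

theory Defs
  imports
    "Jordan_Normal_Form.DL_Submatrix"
    "HOL-Combinatorics.Permutations"
    "Graph_Theory.Digraph_Component"
begin

(* Matrices are indexed from 0, so the index set [n] is {0..<n}. *)

definition skew_symmetric :: "real mat \<Rightarrow> bool" where
  "skew_symmetric A \<longleftrightarrow> square_mat A \<and>
     (\<forall>i < dim_row A. \<forall>j < dim_row A. A $$ (j, i) = - A $$ (i, j))"

(* Intended for square matrices only. *)
definition permanent :: "real mat \<Rightarrow> real" where
  "permanent A = (\<Sum>p | p permutes {0..<dim_row A}. \<Prod>i = 0..<dim_row A. A $$ (i, p i))"

definition ppr_entry :: "real mat \<Rightarrow> nat \<Rightarrow> nat" where
  "ppr_entry A k =
     (if k = 0 then (if \<exists>i < dim_row A. A $$ (i, i) = 0 then 1 else 0)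
      else (if \<exists>I \<subseteq> {0..<dim_row A}. card I = k \<and> permanent (submatrix A I I) \<noteq> 0
            then 1 else 0))"

definition ppr :: "real mat \<Rightarrow> nat list" where
  "ppr A = map (ppr_entry A) [0..<Suc (dim_row A)]"

(* A simple undirected graph is represented as a finite loop-free symmetric digraph
   (locale pair_graph): an edge {u, v} is the pair of arcs (u, v) and (v, u). *)

definition underlying_graph :: "real mat \<Rightarrow> nat pair_pre_digraph" where
  "underlying_graph A =
     \<lparr> pverts = {0..<dim_row A},
       parcs = {(i, j). i < dim_row A \<and> j < dim_row A \<and> A $$ (i, j) \<noteq> 0} \<rparr>"

(* The library's predicate tree forbids all directed cycles, in particular u, v, u, so it
   fails for every symmetric digraph with an edge.  Undirected cycles are those directed
   cycles that have at least three arcs. *)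
definition undirected_tree :: "'a pair_pre_digraph \<Rightarrow> bool" where
  "undirected_tree G \<longleftrightarrow> pair_graph G \<and> connected (with_proj G) \<and>
     \<not> (\<exists>p. pre_digraph.cycle (with_proj G) p \<and> 3 \<le> length p)"

definition undirected_edges :: "'a pair_pre_digraph \<Rightarrow> 'a set set" where
  "undirected_edges G = {{u, v} | u v. (u, v) \<in> parcs G}"

definition matching :: "'a pair_pre_digraph \<Rightarrow> 'a set set \<Rightarrow> bool" where
  "matching G M \<longleftrightarrow> M \<subseteq> undirected_edges G \<and>
     (\<forall>e \<in> M. \<forall>f \<in> M. e \<noteq> f \<longrightarrow> e \<inter> f = {})"

definition matching_number :: "'a pair_pre_digraph \<Rightarrow> nat" where
  "matching_number G = Max {card M | M. matching G M}"

end

theory Submission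
  imports Defs "HOL-Combinatorics.Cycles"
begin

text \<open>
  Expand the permanent of a principal submatrix over the permutations \<open>p\<close> of its index set.  A nonzero
  term has \<open>i\<close> adjacent to \<open>p i\<close> for all \<open>i\<close>, so in a tree the orbits of \<open>p\<close>, being closed walks without
  repeated vertices, have length two: \<open>p\<close> is a perfect matching of the index set.  By skew-symmetry
  the term is then \<open>(- 1) ^ (k div 2)\<close> times a product of squares.  All nonzero terms of order \<open>k\<close> thus
  have the same sign and cannot cancel, and \<open>r\<^sub>k = 1\<close> just when there is a matching with \<open>k / 2\<close> edges.
  Realizability follows by orienting a given tree on \<open>{0..<n}\<close> by means of the order.
\<close>

section \<open>Principal permanents as sums over permutations of the index set\<close>

lemma bij_betw_pick:
  \<comment> \<open>For \<open>k < card I\<close>, \<open>pick I k\<close> is the element of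
    \<open>I\<close> with exactly \<open>k\<close> smaller elements in \<open>I\<close>, so the
    inverse is the rank function.\<close>
  assumes "finite I"
  shows "bij_betw (pick I) {0..<card I} I"
proof (rule bij_betwI[where g = "\<lambda>i. card {a \<in> I. a < i}"])
  show "pick I \<in> {0..<card I} \<rightarrow> I" by (auto intro: pick_in_set_le)
  show "(\<lambda>i. card {a \<in> I. a < i}) \<in> I \<rightarrow> {0..<card I}"
  proof
    fix i assume "i \<in> I"
    then have "{a \<in> I. a < i} \<subset> I" by auto
    then show "card {a \<in> I. a < i} \<in> {0..<card I}"
      using assms by (simp add: psubset_card_mono)
  qed
  show "card {a \<in> I. a < pick I x} = x" if "x \<in> {0..<card I}" for x
    using that by (intro card_pick) simp
  show "pick I (card {a \<in> I. a < y}) = y" if "y \<in> I" for y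
    using that by (rule pick_card_in_set)
qed

text \<open>\<open>map_permutation A f\<close> is conjugation by \<open>f\<close>, which is undone
  by conjugation with the inverse bijection.\<close>

lemma bij_betw_map_permutation:
  assumes f: "bij_betw f A B"
  shows "bij_betw (map_permutation A f) {p. p permutes A} {q. q permutes B}"
proof -
  have g: "bij_betw (inv_into A f) B A" using f by (rule bij_betw_inv_into)
  have "map_permutation B (inv_into A f) (map_permutation A f p) = p" if "p permutes A" for p
    using map_permutation_compose_inv[OF f that] bij_betw_inv_into_left[OF f] by blast
  moreover have "map_permutation A f (map_permutation B (inv_into A f) q) = q" if "q permutes B" for q
    using map_permutation_compose_inv[OF g that] bij_betw_inv_into_right[OF f] by blast
  ultimately show ?thesis
    using map_permutation_permutes[OF f] map_permutation_permutes[OF g]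
    by (intro bij_betwI[where g = "map_permutation B (inv_into A f)"]) auto
qed

text \<open>\<open>submatrix\<close> renumbers the rows and columns by \<open>pick I\<close>.
  Conjugating each permutation with this bijection undoes the renumbering, so that afterwards
  permutations act on \<open>I\<close> itself, that is, on vertices of the graph.\<close>

lemma permanent_submatrix:
  assumes sq: "dim_col A = dim_row A" and I: "I \<subseteq> {0..<dim_row A}"
  shows "permanent (submatrix A I I) = (\<Sum>p | p permutes I. \<Prod>i\<in>I. A $$ (i, p i))"
proof -
  let ?K = "{0..<card I}"
  have "finite I" using I finite_subset by blast
  then have h: "bij_betw (pick I) ?K I" by (rule bij_betw_pick)
  have sel: "{i. i < dim_row A \<and> i \<in> I} = I" using I by auto
  have "permanent (submatrix A I I)
      = (\<Sum>q | q permutes ?K. \<Prod>k\<in>?K. submatrix A I I $$ (k, q k))"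
    by (simp add: permanent_def dim_submatrix sel)
  also have "\<dots> = (\<Sum>q | q permutes ?K. \<Prod>k\<in>?K. A $$ (pick I k, pick I (q k)))"
  proof (intro sum.cong prod.cong refl)
    fix q k assume "q \<in> {q. q permutes ?K}" and k: "k \<in> ?K"
    then have "q k \<in> ?K" using permutes_in_image[of q ?K k] by simp
    with k show "submatrix A I I $$ (k, q k) = A $$ (pick I k, pick I (q k))"
      by (intro submatrix_index) (simp_all add: sel sq)
  qed
  also have "\<dots> = (\<Sum>q | q permutes ?K. \<Prod>i\<in>I. A $$ (i, map_permutation ?K (pick I) q i))"
  proof (intro sum.cong refl)
    fix q assume "q \<in> {q. q permutes ?K}"
    show "(\<Prod>k\<in>?K. A $$ (pick I k, pick I (q k)))
        = (\<Prod>i\<in>I. A $$ (i, map_permutation ?K (pick I) q i))"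
      unfolding prod.reindex_bij_betw[OF h, symmetric]
      using h by (intro prod.cong refl) (simp add: map_permutation_apply bij_betw_def)
  qed
  also have "\<dots> = (\<Sum>p | p permutes I. \<Prod>i\<in>I. A $$ (i, p i))"
    by (rule sum.reindex_bij_betw[OF bij_betw_map_permutation[OF h]])
  finally show ?thesis .
qed

section \<open>Permutation orbits as cycles of the graph\<close>

lemma pcas_map_upt:
  "m \<le> n \<Longrightarrow> pcas (h m) (map (\<lambda>i. (h i, h (Suc i))) [m..<n]) (h n)"
\<comment> \<open>\<open>pcas\<close> recurses on the first arc, so the walk loses its first vertex
  in each step: \<open>m\<close> varies while \<open>n\<close> stays fixed.\<close>
proof (induction "n - m" arbitrary: m)
  case (Suc d)
  then have "m < n" "d = n - Suc m" "Suc m \<le> n" by auto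
  with Suc.hyps(1)[of "Suc m"] show ?case by (simp add: upt_conv_Cons)
qed auto

text \<open>The vertices of a walk after its start are the heads of its arcs. In this form cycles
  are easily built from explicit lists of arcs and carried along maps of vertices.\<close>

lemma cycle_with_proj_iff:
  "pre_digraph.cycle (with_proj G) c \<longleftrightarrow>
    (\<exists>u\<in>pverts G. set c \<subseteq> parcs G \<and> pcas u c u \<and> distinct (map snd c) \<and> c \<noteq> [])"
proof -
  have "tl (pawalk_verts u c) = map snd c" if "pcas u c u" "c \<noteq> []" for u
    using pre_digraph.awalk_verts_conv'[of "with_proj G" u c u] that
    by (simp add: cas_with_proj_eq awalk_verts_with_proj_eq)
  then show ?thesis
    by (auto simp: pre_digraph.cycle_def pre_digraph.awalk_def cas_with_proj_eq
        awalk_verts_with_proj_eq)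
qed

text \<open>Iterating \<open>p\<close> from \<open>x\<close> gives a walk that closes up after
  \<open>least_power p x\<close> steps and repeats no vertex before.\<close>

lemma cycle_of_permutation_orbit:
  assumes p: "p permutes I" "finite I" and x: "x \<in> I" and I: "I \<subseteq> pverts G"
    and arcs: "\<And>i. i \<in> I \<Longrightarrow> (i, p i) \<in> parcs G"
  shows "pre_digraph.cycle (with_proj G)
           (map (\<lambda>i. ((p ^^ i) x, (p ^^ Suc i) x)) [0..<least_power p x])"
    (is "pre_digraph.cycle _ ?c")
proof -
  have perm: "permutation p" using p permutation_permutes by blast
  define h where "h i = (p ^^ i) x" for i
  have hI: "h i \<in> I" for i
    using x p(1) by (induction i) (auto simp: h_def permutes_in_image)
  have n: "0 < least_power p x" "h (least_power p x) = h 0"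
    using least_power_of_permutation[OF perm, of x] by (auto simp: h_def)
  have c: "?c = map (\<lambda>i. (h i, h (Suc i))) [0..<least_power p x]" by (simp add: h_def)
  have cas: "pcas (h 0) ?c (h 0)"
    using pcas_map_upt[of 0 "least_power p x" h] n(2) unfolding c by simp
  \<comment> \<open>The heads are the orbit shifted by one step, the image under the injective
    \<open>p\<close> of the duplicate-free list \<open>support p x\<close>.\<close>
  have "map snd ?c = map p (support p x)" by simp
  moreover have "distinct (map p (support p x))"
    using cycle_of_permutation[OF perm, of x] permutes_inj_on[OF p(1)]
    by (simp add: distinct_map del: map_map)
  ultimately have "distinct (map snd ?c)" by metis
  moreover have "set ?c \<subseteq> parcs G" using arcs[OF hI] by (auto simp: h_def)
  moreover have "?c \<noteq> []" using n by simp
  ultimately show ?thesis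
    using cas hI[of 0] I unfolding cycle_with_proj_iff by blast
qed

text \<open>The orbit of a point of \<open>I\<close> is a directed cycle, so it has fewer than three
  points, and it has more than one because there are no loops. Points outside \<open>I\<close> are
  fixed by \<open>p\<close>.\<close>

lemma permutes_along_arcs_involution:
  assumes G: "pair_loopfree_digraph G"
    and acyclic: "\<not> (\<exists>c. pre_digraph.cycle (with_proj G) c \<and> 3 \<le> length c)"
    and p: "p permutes I" "finite I" and I: "I \<subseteq> pverts G"
    and arcs: "\<And>i. i \<in> I \<Longrightarrow> (i, p i) \<in> parcs G"
  shows "p (p x) = x"
proof (cases "x \<in> I")
  case True
  interpret pair_loopfree_digraph G by fact
  have perm: "permutation p" using p permutation_permutes by blast
  let ?n = "least_power p x"
  have "?n < 3" using cycle_of_permutation_orbit[OF p True I arcs] acyclic by fastforce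
  moreover have "p x \<noteq> x" using arcs[OF True] pair_no_loops by force
  ultimately have "?n = 2" using least_power_gt_one[OF perm, of x] by simp
  then show ?thesis
    using least_power_of_permutation(1)[OF perm, of x] by (simp add: numeral_2_eq_2)
next
  case False
  then show ?thesis using p(1) by (simp add: permutes_not_in)
qed

section \<open>Signs of the terms and nonvanishing of principal permanents\<close>

lemma skew_symmetricD:
  "skew_symmetric A \<Longrightarrow> i < dim_row A \<Longrightarrow> j < dim_row A \<Longrightarrow> A $$ (j, i) = - A $$ (i, j)"
  unfolding skew_symmetric_def by blast

text \<open>The points \<open>i\<close> and \<open>p i\<close> together contribute
  \<open>A $$ (i, p i) * A $$ (p i, i)\<close>, the negative of a square, and there are
  \<open>card I div 2\<close> such pairs.\<close>

lemma prod_skew_involution: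
  assumes A: "skew_symmetric A" and I: "I \<subseteq> {0..<dim_row A}"
    and p: "p permutes I" and inv: "\<And>i. p (p i) = i" and nofix: "\<And>i. i \<in> I \<Longrightarrow> p i \<noteq> i"
  shows "(\<Prod>i\<in>I. A $$ (i, p i))
    = (- 1) ^ (card I div 2) * (\<Prod>i | i \<in> I \<and> i < p i. (A $$ (i, p i))\<^sup>2)"
proof -
  \<comment> \<open>\<open>?J\<close> collects the smaller and \<open>?K\<close> the larger point of
    each pair; \<open>p\<close> interchanges the two sets.\<close>
  let ?J = "{i \<in> I. i < p i}" and ?K = "{i \<in> I. p i < i}"
  have fin: "finite I" using I finite_subset by blast
  have pI: "p i \<in> I \<longleftrightarrow> i \<in> I" for i using p by (rule permutes_in_image)
  have split: "I = ?J \<union> ?K" using nofix by (auto simp: neq_iff)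
  have bij: "bij_betw p ?J ?K"
    by (rule bij_betwI[where g = p]) (auto simp: pI inv)
  have "card I = card ?J + card ?K"
    using fin by (subst split, subst card_Un_disjoint) auto
  also have "card ?K = card ?J" using bij_betw_same_card[OF bij] by simp
  finally have card: "card I = 2 * card ?J" by simp
  have "(\<Prod>i\<in>I. A $$ (i, p i)) = (\<Prod>i\<in>?J. A $$ (i, p i)) * (\<Prod>i\<in>?K. A $$ (i, p i))"
    using fin by (subst split, subst prod.union_disjoint) auto
  also have "(\<Prod>i\<in>?K. A $$ (i, p i)) = (\<Prod>i\<in>?J. A $$ (p i, i))"
    using prod.reindex_bij_betw[OF bij, of "\<lambda>i. A $$ (i, p i)"] by (simp add: inv)
  also have "\<dots> = (\<Prod>i\<in>?J. - A $$ (i, p i))"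
  proof (intro prod.cong refl)
    fix i assume "i \<in> ?J"
    then have "i < dim_row A" "p i < dim_row A" using I pI[of i] by auto
    then show "A $$ (p i, i) = - A $$ (i, p i)" by (rule skew_symmetricD[OF A])
  qed
  also have "(\<Prod>i\<in>?J. A $$ (i, p i)) * \<dots> = (\<Prod>i\<in>?J. - 1 * (A $$ (i, p i))\<^sup>2)"
    by (simp add: prod.distrib[symmetric] power2_eq_square)
  also have "\<dots> = (- 1) ^ card ?J * (\<Prod>i\<in>?J. (A $$ (i, p i))\<^sup>2)"
    by (subst prod.distrib) simp
  finally show "(\<Prod>i\<in>I. A $$ (i, p i)) = (- 1) ^ (card I div 2) * (\<Prod>i\<in>?J. (A $$ (i, p i))\<^sup>2)"
    by (simp add: card)
qed

text \<open>After multiplication by the sign \<open>(- 1) ^ (card I div 2)\<close>, which depends on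
  \<open>I\<close> only, every term of the expansion is nonnegative, and positive exactly for the
  permutations on the right-hand side. Hence no cancellation can occur.\<close>

lemma permanent_submatrix_nonzero_iff:
  assumes A: "skew_symmetric A" and T: "undirected_tree (underlying_graph A)"
    and I: "I \<subseteq> {0..<dim_row A}"
  shows "permanent (submatrix A I I) \<noteq> 0 \<longleftrightarrow>
    (\<exists>p. p permutes I \<and> (\<forall>i. p (p i) = i) \<and> (\<forall>i\<in>I. (i, p i) \<in> parcs (underlying_graph A)))"
    (is "_ \<longleftrightarrow> (\<exists>p. ?P p)")
proof -
  let ?G = "underlying_graph A"
  have fin: "finite I" using I finite_subset by blast
  interpret pair_graph ?G using T by (simp add: undirected_tree_def)
  have acyclic: "\<not> (\<exists>c. pre_digraph.cycle (with_proj ?G) c \<and> 3 \<le> length c)"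
    using T by (simp add: undirected_tree_def)
  have sq: "dim_col A = dim_row A" using A unfolding skew_symmetric_def by simp
  let ?t = "\<lambda>p. \<Prod>i\<in>I. A $$ (i, p i)"
  \<comment> \<open>A nonzero product has only nonzero factors, so \<open>p\<close> moves along arcs
    and the absence of long cycles applies.\<close>
  have invol: "?P p" if p: "p permutes I" and "?t p \<noteq> 0" for p
  proof -
    have arcs: "(i, p i) \<in> parcs ?G" if "i \<in> I" for i
      using that \<open>?t p \<noteq> 0\<close> fin I permutes_in_image[OF p, of i]
      by (auto simp: underlying_graph_def)
    moreover have "p (p i) = i" for i
      using permutes_along_arcs_involution[OF pair_loopfree_digraph_axioms acyclic p fin _ arcs] I
      by (simp add: underlying_graph_def)
    ultimately show ?thesis using p by auto
  qed
  have sgn: "(- 1) ^ (card I div 2) * ?t p > 0" if "?P p" for p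
  proof -
    have "p i \<noteq> i" if "i \<in> I" for i using \<open>?P p\<close> that pair_no_loops by force
    \<comment> \<open>The sign now occurs twice and cancels; nonzero squares remain.\<close>
    then have "(- 1) ^ (card I div 2) * ?t p = (\<Prod>i | i \<in> I \<and> i < p i. (A $$ (i, p i))\<^sup>2)"
      using prod_skew_involution[OF A I, of p] that
      by (simp add: mult.assoc[symmetric] power_add[symmetric])
    also have "\<dots> > 0" using that by (intro prod_pos) (auto simp: underlying_graph_def)
    finally show ?thesis .
  qed
  have nonneg: "(- 1) ^ (card I div 2) * ?t p \<ge> 0" if "p permutes I" for p
    using invol[OF that] sgn[of p] by (cases "?t p = 0") auto
  have per: "(- 1) ^ (card I div 2) * permanent (submatrix A I I)
      = (\<Sum>p | p permutes I. (- 1) ^ (card I div 2) * ?t p)"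
    by (simp add: permanent_submatrix[OF sq I] sum_distrib_left)
  show ?thesis
  proof
    assume "permanent (submatrix A I I) \<noteq> 0"
    then obtain p where "p permutes I" "?t p \<noteq> 0"
      unfolding permanent_submatrix[OF sq I] by (auto elim: sum.not_neutral_contains_not_neutral)
    then show "\<exists>p. ?P p" using invol by blast
  next
    assume "\<exists>p. ?P p"
    then obtain p where p: "?P p" ..
    have "0 < (\<Sum>p | p permutes I. (- 1) ^ (card I div 2) * ?t p)"
      using p sgn[OF p] nonneg finite_permutations[OF fin] by (intro sum_pos2[of _ p]) auto
    then show "permanent (submatrix A I I) \<noteq> 0" unfolding per[symmetric] by auto
  qed
qed

section \<open>Matchings as involutions along edges\<close>

lemma matching_of_involution:
  assumes p: "p permutes I" "\<And>i. p (p i) = i" and arcs: "\<And>i. i \<in> I \<Longrightarrow> (i, p i) \<in> parcs G"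
  shows "matching G ((\<lambda>i. {i, p i}) ` I)" and "\<Union>((\<lambda>i. {i, p i}) ` I) = I"
proof -
  \<comment> \<open>Either end of an edge \<open>{i, p i}\<close> determines the other, so edges
    with a common vertex coincide.\<close>
  show "matching G ((\<lambda>i. {i, p i}) ` I)"
    unfolding matching_def undirected_edges_def using p(2) arcs by (auto, metis+)
  show "\<Union>((\<lambda>i. {i, p i}) ` I) = I" using permutes_in_image[OF p(1)] by auto
qed

lemma matching_edgeE:
  assumes "matching G M" "e \<in> M"
  obtains u v where "e = {u, v}" "(u, v) \<in> parcs G"
  using assms unfolding matching_def undirected_edges_def by blast

lemma matching_eqI:
  "matching G M \<Longrightarrow> d \<in> M \<Longrightarrow> e \<in> M \<Longrightarrow> x \<in> d \<Longrightarrow> x \<in> e \<Longrightarrow> d = e"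
  unfolding matching_def by blast

lemma (in pair_wf_digraph) matching_subset_Pow_pverts: "matching G M \<Longrightarrow> M \<subseteq> Pow (pverts G)"
  by (auto elim!: matching_edgeE dest: wellformed')

text \<open>The involution exchanges the two ends of each edge of the matching.\<close>

lemma involution_of_matching:
  assumes G: "pair_graph G" and M: "matching G M"
  obtains p where "p permutes \<Union>M" "\<And>i. p (p i) = i" "\<And>i. i \<in> \<Union>M \<Longrightarrow> (i, p i) \<in> parcs G"
proof -
  interpret pair_graph G by fact
  \<comment> \<open>An unordered edge may come from either of its two arcs; symmetry of the graph
    supplies the other one.\<close>
  have edge: "(i, j) \<in> parcs G" if "{i, j} \<in> M" for i j
  proof -
    from M that obtain u v where "{i, j} = {u, v}" "(u, v) \<in> parcs G" by (rule matching_edgeE)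
    then show ?thesis using arcs_symmetric by (auto simp: doubleton_eq_iff)
  qed
  have uniq: "j = k" if "{i, j} \<in> M" "{i, k} \<in> M" for i j k
  proof -
    have "{i, j} = {i, k}" using matching_eqI[OF M that, of i] by simp
    then show ?thesis by (auto simp: doubleton_eq_iff)
  qed
  have ex: "\<exists>j. {i, j} \<in> M" if "i \<in> \<Union>M" for i
  proof -
    from that obtain e where "i \<in> e" "e \<in> M" by blast
    moreover from M \<open>e \<in> M\<close> obtain u v where "e = {u, v}" by (rule matching_edgeE)
    ultimately show ?thesis by (auto simp: insert_commute)
  qed
  \<comment> \<open>Outside \<open>\<Union>M\<close> the value is \<open>i\<close>, as
    \<open>permutes\<close> demands; this also gives \<open>p (p i) = i\<close> there.\<close>
  define p where "p i = (if i \<in> \<Union>M then THE j. {i, j} \<in> M else i)" for i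
  have pM: "{i, p i} \<in> M" if "i \<in> \<Union>M" for i
    using theI'[of "\<lambda>j. {i, j} \<in> M"] ex[OF that] uniq that by (auto simp: p_def)
  have inv: "p (p i) = i" for i
  proof (cases "i \<in> \<Union>M")
    case True
    then have "{p i, i} \<in> M" "p i \<in> \<Union>M" using pM[OF True] by (auto simp: insert_commute)
    then show ?thesis using pM uniq by blast
  qed (auto simp: p_def)
  have "p permutes \<Union>M"
  proof (rule bij_imp_permutes)
    have "p ` \<Union>M \<subseteq> \<Union>M" using pM by blast
    then show "bij_betw p (\<Union>M) (\<Union>M)"
      using inv by (intro bij_betwI[where g = p]) (auto simp del: Union_iff)
  qed (simp add: p_def)
  then show thesis using inv edge[OF pM] that by blast
qed

text \<open>The edges are disjoint, and each has two distinct ends because there are no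
  loops.\<close>

lemma card_Union_matching:
  assumes G: "pair_graph G" and M: "matching G M"
  shows "card (\<Union>M) = 2 * card M"
proof -
  interpret pair_graph G by fact
  have sub: "M \<subseteq> Pow (pverts G)" using M by (rule matching_subset_Pow_pverts)
  then have "finite M" using pair_finite_verts finite_subset by blast
  moreover have "finite (\<Union>M)" using sub by (intro finite_subset[OF _ pair_finite_verts]) blast
  moreover have "card e = 2" if "e \<in> M" for e
    using M that by (elim matching_edgeE) (auto dest: no_loops')
  ultimately show ?thesis using card_partition[of M 2] M by (simp add: matching_def)
qed

lemma finite_matchings:
  assumes "pair_graph G"
  shows "finite {M. matching G M}"
proof -
  interpret pair_graph G by fact
  have "finite (Pow (Pow (pverts G)))" using pair_finite_verts by simp
  moreover have "{M. matching G M} \<subseteq> Pow (Pow (pverts G))"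
    using matching_subset_Pow_pverts by blast
  ultimately show ?thesis by (rule finite_subset[rotated])
qed

text \<open>Every subset of a matching is a matching, so all sizes up to the maximum occur.\<close>

lemma ex_matching_card_iff:
  assumes G: "pair_graph G"
  shows "(\<exists>M. matching G M \<and> card M = k) \<longleftrightarrow> k \<le> matching_number G"
proof
  let ?S = "{card M | M. matching G M}"
  have fin: "finite ?S" using finite_matchings[OF G] by simp
  { assume "\<exists>M. matching G M \<and> card M = k"
    then show "k \<le> matching_number G"
      unfolding matching_number_def using fin by (intro Max_ge) auto }
  \<comment> \<open>The empty matching makes the set of sizes nonempty, so that its
    \<open>Max\<close> is attained.\<close>
  have "matching G {}" by (simp add: matching_def)
  then have "Max ?S \<in> ?S" using fin by (intro Max_in) auto
  then obtain M where M: "matching G M" "card M = matching_number G"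
    by (auto simp: matching_number_def)
  assume "k \<le> matching_number G"
  then obtain N where "N \<subseteq> M" "card N = k" using M(2) by (metis obtain_subset_with_card_n)
  then show "\<exists>M. matching G M \<and> card M = k"
    using M(1) unfolding matching_def by (intro exI[of _ N]) blast
qed

section \<open>The ppr-sequence of a skew-symmetric tree matrix\<close>

lemma ex_permanent_submatrix_nonzero_iff:
  assumes A: "skew_symmetric A" and T: "undirected_tree (underlying_graph A)"
  shows "(\<exists>I \<subseteq> {0..<dim_row A}. card I = k \<and> permanent (submatrix A I I) \<noteq> 0) \<longleftrightarrow>
    even k \<and> k \<le> 2 * matching_number (underlying_graph A)"
proof -
  let ?G = "underlying_graph A"
  have G: "pair_graph ?G" using T by (simp add: undirected_tree_def)
  then interpret pair_graph ?G .
  \<comment> \<open>The index sets with nonzero permanent are the vertex sets covered by matchings,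
    and a matching covers twice as many vertices as it has edges.\<close>
  have "(\<exists>I \<subseteq> {0..<dim_row A}. card I = k \<and> permanent (submatrix A I I) \<noteq> 0) \<longleftrightarrow>
      (\<exists>M. matching ?G M \<and> 2 * card M = k)"
  proof (intro iffI; elim exE conjE)
    fix I assume I: "I \<subseteq> {0..<dim_row A}" and k: "card I = k"
      and "permanent (submatrix A I I) \<noteq> 0"
    then obtain p where "p permutes I" "\<And>i. p (p i) = i" "\<And>i. i \<in> I \<Longrightarrow> (i, p i) \<in> parcs ?G"
      using permanent_submatrix_nonzero_iff[OF A T I] by auto
    note M = matching_of_involution[OF this]
    then show "\<exists>M. matching ?G M \<and> 2 * card M = k"
      using card_Union_matching[OF G M(1)] k by auto
  next
    fix M assume M: "matching ?G M" and k: "2 * card M = k"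
    have "\<Union>M \<subseteq> {0..<dim_row A}"
      using matching_subset_Pow_pverts[OF M] by (auto simp: underlying_graph_def)
    moreover obtain p where "p permutes \<Union>M" "\<And>i. p (p i) = i"
        "\<And>i. i \<in> \<Union>M \<Longrightarrow> (i, p i) \<in> parcs ?G"
      using involution_of_matching[OF G M] by metis
    ultimately show "\<exists>I \<subseteq> {0..<dim_row A}. card I = k \<and> permanent (submatrix A I I) \<noteq> 0"
      using permanent_submatrix_nonzero_iff[OF A T, of "\<Union>M"] card_Union_matching[OF G M] k by metis
  qed
  also have "\<dots> \<longleftrightarrow> even k \<and> (\<exists>M. matching ?G M \<and> card M = k div 2)" by auto
  also have "\<dots> \<longleftrightarrow> even k \<and> k \<le> 2 * matching_number ?G"
    unfolding ex_matching_card_iff[OF G] by auto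
  finally show ?thesis .
qed

lemma ppr_nth: "k \<le> dim_row A \<Longrightarrow> ppr A ! k = ppr_entry A k"
  by (simp add: ppr_def del: upt_Suc)

lemma ppr_skew_symmetric_tree:
  assumes A: "skew_symmetric A" and T: "undirected_tree (underlying_graph A)" and k: "k \<le> dim_row A"
  shows "ppr A ! k = 1 \<longleftrightarrow> even k \<and> k \<le> 2 * matching_number (underlying_graph A)"
proof (cases "k = 0")
  case True
  \<comment> \<open>The entry at 0 concerns the diagonal, not a permanent. Connectedness includes
    having a vertex, so a diagonal entry exists, and skew-symmetry makes it zero.\<close>
  have "pverts (underlying_graph A) \<noteq> {}"
    using T unfolding undirected_tree_def connected_conv with_proj_simps by (elim conjE)
  then have "0 < dim_row A" by (auto simp: underlying_graph_def)
  moreover from this have "A $$ (0, 0) = 0" using skew_symmetricD[OF A, of 0 0] by simp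
  ultimately show ?thesis using True by (auto simp: ppr_nth ppr_entry_def)
next
  case False
  then show ?thesis using ex_permanent_submatrix_nonzero_iff[OF A T, of k] k
    by (simp add: ppr_nth ppr_entry_def)
qed

section \<open>Transport of trees and matchings along a relabelling of the vertices\<close>

definition map_graph :: "('a \<Rightarrow> 'b) \<Rightarrow> 'a pair_pre_digraph \<Rightarrow> 'b pair_pre_digraph" where
  "map_graph f G = \<lparr> pverts = f ` pverts G, parcs = map_prod f f ` parcs G \<rparr>"

text \<open>This exhibits the original graph as a relabelling of its image, so that cycles and
  matchings of the image can be pulled back by the lemmas that push them forward.\<close>

lemma map_graph_inverse:
  assumes "pair_wf_digraph G" and "\<And>v. v \<in> pverts G \<Longrightarrow> g (f v) = v"
  shows "map_graph g (map_graph f G) = G"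
proof -
  interpret pair_wf_digraph G by fact
  have "map_prod g g (map_prod f f e) = e" if "e \<in> parcs G" for e
    using that assms(2) arc_fst_in_verts arc_snd_in_verts by (cases e) fastforce
  then have "(\<lambda>e. map_prod g g (map_prod f f e)) ` parcs G = parcs G" by simp
  then show ?thesis using assms(2) by (simp add: map_graph_def image_image)
qed

lemma pair_graph_map_graph:
  assumes G: "pair_graph G" and f: "inj_on f (pverts G)"
  shows "pair_graph (map_graph f G)"
proof -
  interpret pair_graph G by fact
  have "symmetric (with_proj (map_graph f G))"
    using arcs_symmetric by (force simp: symmetric_def map_graph_def intro!: symI)
  moreover have "f u \<noteq> f v" if "(u, v) \<in> parcs G" for u v
    using f no_loops'[OF that] wellformed'[OF that] by (auto dest: inj_onD)
  ultimately show ?thesis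
    using pair_finite_verts pair_finite_arcs
    by unfold_locales (auto simp: map_graph_def dest: wellformed')
qed

lemma connected_map_graph:
  assumes "connected (with_proj G)"
  shows "connected (with_proj (map_graph f G))"
proof -
  have "(f u, f v) \<in> rtrancl_on (f ` pverts G) ((map_prod f f ` parcs G)\<^sup>s)"
    if "(u, v) \<in> rtrancl_on (pverts G) ((parcs G)\<^sup>s)" for u v
    using that
  proof induction
    case (step x y)
    then have "(f x, f y) \<in> (map_prod f f ` parcs G)\<^sup>s" by (auto simp: symcl_def)
    with step show ?case by (auto intro: converse_rtrancl_on_into_rtrancl_on)
  qed auto
  then show ?thesis using assms by (auto simp: connected_conv map_graph_def)
qed

lemma pcas_map: "pcas u c v \<Longrightarrow> pcas (f u) (map (map_prod f f) c) (f v)"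
  by (induction c arbitrary: u) auto

lemma cycle_map_graph:
  assumes f: "inj_on f (pverts G)" and G: "pair_wf_digraph G"
    and c: "pre_digraph.cycle (with_proj G) c"
  shows "pre_digraph.cycle (with_proj (map_graph f G)) (map (map_prod f f) c)"
proof -
  interpret pair_wf_digraph G by fact
  from c obtain u where u: "u \<in> pverts G" "set c \<subseteq> parcs G" "pcas u c u" "c \<noteq> []"
    and d: "distinct (map snd c)"
    unfolding cycle_with_proj_iff by blast
  \<comment> \<open>Injectivity of \<open>f\<close> is known only on vertices, so the heads must be
    vertices for their images to stay distinct.\<close>
  have "set (map snd c) \<subseteq> pverts G"
    using subsetD[OF u(2)] arc_snd_in_verts unfolding set_map by (intro image_subsetI) blast
  then have "distinct (map f (map snd c))"
    using d f inj_on_subset by (subst distinct_map) blast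
  then have "distinct (map snd (map (map_prod f f) c))" by (simp add: comp_def)
  then show ?thesis
    using u(1,2,4) pcas_map[OF u(3), of f] unfolding cycle_with_proj_iff
    by (intro bexI[of _ "f u"]) (auto simp: map_graph_def simp del: map_map)
qed

text \<open>A cycle in the image is pulled back by the inverse relabelling to a cycle of the same
  length, so none has three or more arcs.\<close>

lemma undirected_tree_map_graph:
  assumes T: "undirected_tree G" and f: "inj_on f (pverts G)"
  shows "undirected_tree (map_graph f G)"
proof -
  have G: "pair_graph G" using T by (simp add: undirected_tree_def)
  interpret pair_graph G by fact
  interpret F: pair_graph "map_graph f G" using pair_graph_map_graph[OF G f] .
  let ?g = "inv_into (pverts G) f"
  have g: "inj_on ?g (pverts (map_graph f G))"
    by (auto simp: map_graph_def intro: inj_on_inv_into)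
  have G_eq: "map_graph ?g (map_graph f G) = G"
    using f by (intro map_graph_inverse) (auto simp: pair_wf_digraph_axioms)
  have "\<not> (pre_digraph.cycle (with_proj (map_graph f G)) c \<and> 3 \<le> length c)" for c
    using cycle_map_graph[OF g F.pair_wf_digraph_axioms, of c] T
    unfolding G_eq undirected_tree_def by (metis length_map)
  then show ?thesis
    using T connected_map_graph F.pair_graph_axioms by (auto simp: undirected_tree_def)
qed

lemma matching_map_graph:
  assumes f: "inj_on f (pverts G)" and G: "pair_wf_digraph G" and M: "matching G M"
  shows "matching (map_graph f G) ((`) f ` M)" and "card ((`) f ` M) = card M"
proof -
  interpret pair_wf_digraph G by fact
  have sub: "e \<subseteq> pverts G" if "e \<in> M" for e
    using matching_subset_Pow_pverts[OF M] that by blast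
  have "f ` e \<in> undirected_edges (map_graph f G)" if "e \<in> M" for e
  proof -
    from M that obtain u v where "e = {u, v}" "(u, v) \<in> parcs G" by (rule matching_edgeE)
    then have "f ` e = {f u, f v}" "(f u, f v) \<in> parcs (map_graph f G)"
      by (auto simp: map_graph_def intro: rev_image_eqI)
    then show ?thesis unfolding undirected_edges_def by blast
  qed
  moreover have "f ` d \<inter> f ` e = {}" if "d \<in> M" "e \<in> M" "f ` d \<noteq> f ` e" for d e
  proof -
    have "d \<inter> e = {}" using matching_eqI[OF M \<open>d \<in> M\<close> \<open>e \<in> M\<close>] that(3) by blast
    then show ?thesis using inj_on_image_Int[OF f sub sub, of d e] that by simp
  qed
  ultimately show "matching (map_graph f G) ((`) f ` M)" by (auto simp: matching_def)
  have "inj_on ((`) f) M"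
    by (rule inj_on_subset[OF inj_on_image_Pow[OF f] matching_subset_Pow_pverts[OF M]])
  then show "card ((`) f ` M) = card M" by (rule card_image)
qed

text \<open>The relabelling and its inverse both carry matchings to matchings of the same size, so
  the same sizes occur in both graphs.\<close>

lemma matching_number_map_graph:
  assumes G: "pair_graph G" and f: "inj_on f (pverts G)"
  shows "matching_number (map_graph f G) = matching_number G"
proof -
  interpret pair_graph G by fact
  interpret F: pair_graph "map_graph f G" using pair_graph_map_graph[OF G f] .
  let ?g = "inv_into (pverts G) f"
  have g: "inj_on ?g (pverts (map_graph f G))"
    by (auto simp: map_graph_def intro: inj_on_inv_into)
  have G_eq: "map_graph ?g (map_graph f G) = G"
    using f by (intro map_graph_inverse) (auto simp: pair_wf_digraph_axioms)
  have "{card M | M. matching (map_graph f G) M} = {card M | M. matching G M}"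
    using matching_map_graph[OF f pair_wf_digraph_axioms]
      matching_map_graph[OF g F.pair_wf_digraph_axioms, unfolded G_eq]
    by (auto, metis+)
  then show ?thesis by (simp add: matching_number_def)
qed

section \<open>Realization by a skew-symmetric matrix\<close>

lemma ex_skew_symmetric_of_pair_graph:
  assumes G: "pair_graph G" and V: "pverts G = {0..<n}"
  obtains B where "B \<in> carrier_mat n n" "skew_symmetric B" "underlying_graph B = G"
proof -
  interpret pair_graph G by fact
  \<comment> \<open>Each edge gets 1 above the diagonal and -1 below it; the diagonal is zero
    because there are no loops.\<close>
  define B :: "real mat" where
    "B = mat n n (\<lambda>(i, j). if (i, j) \<in> parcs G then if i < j then 1 else - 1 else 0)"
  have "skew_symmetric B"
    using arcs_symmetric no_loops' by (auto simp: skew_symmetric_def B_def neq_iff)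
  moreover have "i < n \<and> j < n" if "(i, j) \<in> parcs G" for i j
    using wellformed'[OF that] V by simp
  then have "parcs (underlying_graph B) = parcs G"
    by (auto simp: underlying_graph_def B_def split: if_splits)
  then have "underlying_graph B = G"
    using V by (simp add: underlying_graph_def B_def)
  moreover have "B \<in> carrier_mat n n" by (simp add: B_def)
  ultimately show thesis using that by blast
qed

theorem theorem5p2:
  shows "(\<forall>(n::nat) (A::real mat).
            A \<in> carrier_mat n n \<and> skew_symmetric A \<and> undirected_tree (underlying_graph A) \<longrightarrow>
            (\<forall>k \<le> n. ppr A ! k = 1 \<longleftrightarrow>
                       even k \<and> k \<le> 2 * matching_number (underlying_graph A)))
       \<and> (\<forall>(n::nat) (m::nat).
            (\<exists>H :: 'a pair_pre_digraph.
               undirected_tree H \<and> card (pverts H) = n \<and> matching_number H = m) \<longrightarrow>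
            (\<exists>B::real mat.
               B \<in> carrier_mat n n \<and> skew_symmetric B \<and> undirected_tree (underlying_graph B) \<and>
               (\<forall>k \<le> n. ppr B ! k = 1 \<longleftrightarrow> even k \<and> k \<le> 2 * m)))"
proof (intro conjI allI impI; elim exE conjE)
  fix n k :: nat and A :: "real mat"
  assume "A \<in> carrier_mat n n" "skew_symmetric A" "undirected_tree (underlying_graph A)" "k \<le> n"
  then show "ppr A ! k = 1 \<longleftrightarrow> even k \<and> k \<le> 2 * matching_number (underlying_graph A)"
    by (intro ppr_skew_symmetric_tree) auto
next
  fix n m :: nat and H :: "'a pair_pre_digraph"
  assume H: "undirected_tree H" "card (pverts H) = n" "matching_number H = m"
  then have G: "pair_graph H" by (simp add: undirected_tree_def)
  interpret pair_graph H by fact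
  \<comment> \<open>The vertices of \<open>H\<close> have an arbitrary type, whereas an underlying
    graph lives on \<open>{0..<n}\<close>; hence \<open>H\<close> is first renumbered.\<close>
  obtain f where "bij_betw f (pverts H) {0..<n}"
    using ex_bij_betw_finite_nat[OF pair_finite_verts] H(2) by auto
  then have f: "inj_on f (pverts H)" "pverts (map_graph f H) = {0..<n}"
    by (auto simp: bij_betw_def map_graph_def)
  obtain B where B: "B \<in> carrier_mat n n" "skew_symmetric B" "underlying_graph B = map_graph f H"
    using ex_skew_symmetric_of_pair_graph[OF pair_graph_map_graph[OF G f(1)] f(2)] .
  have T: "undirected_tree (underlying_graph B)"
    using undirected_tree_map_graph[OF H(1) f(1)] B(3) by simp
  have "matching_number (underlying_graph B) = m"
    using matching_number_map_graph[OF G f(1)] B(3) H(3) by simp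
  then show "\<exists>B::real mat. B \<in> carrier_mat n n \<and> skew_symmetric B \<and>
      undirected_tree (underlying_graph B) \<and> (\<forall>k \<le> n. ppr B ! k = 1 \<longleftrightarrow> even k \<and> k \<le> 2 * m)"
    using ppr_skew_symmetric_tree[OF B(2) T] B(1,2) T by (intro exI[of _ B]) auto
qed

end
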